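(* Let $X$ be a topological space, let $I\subset\mathbb{R}$ be an interval, and let $\varphi,\psi,\omega:X\to\mathbb{R}$ and $\alpha,\beta:I\to\mathbb{R}$ be continuous functions. Define $\Phi:X\to]-\infty,+\infty]$ by $$\Phi(x)=\sup_{\lambda\in I}\left(\alpha(\lambda)\varphi(x)+\beta(\lambda)\psi(x)+\omega(x)\right).$$ Assume that: $(i_0)$ there exists a (possibly different) topology $\tau_1$ on $X$ such that, for every $\lambda\in I$, the function $\alpha(\lambda)\varphi(\cdot)+\beta(\lambda)\psi(\cdot)+\omega(\cdot)$ is $\tau_1$-lower semicontinuous and, for some $\lambda_0\in I$, the function $\alpha(\lambda_0)\varphi(\cdot)+\beta(\lambda_0)\psi(\cdot)+\omega(\cdot)$ is $\tau_1$-inf-compact; $(i_1)$ there exists a set $D\subseteq I$, dense in $I$, such that, for each $\lambda\in D$, the function $\alpha(\lambda)\varphi(\cdot)+\beta(\lambda)\psi(\cdot)+\omega(\cdot)$ is inf-connected (with respect to the original topology of $X$); $(i_2')$ the functions $\alpha,\beta$ are differentiable in $A$, where $\mathrm{int}(I)\subseteq A\subseteq I$, $\alpha'(\lambda)\ne0$ for all $\lambda\in A$, the function $g:=\frac{\beta'}{\alpha'}$ is strictly monotone in $A$, and $-\frac{\varphi(x)}{\psi(x)}\in g(A)$ for all $x\in X\setminus\psi^{-1}(0)$. Furthermore, assume that one of the following conditions holds: $(i_3')$ $g$ is increasing in $A$ and $\alpha'(\lambda)\psi(x)<0$ for all $(\lambda,x)\in A\times(X\setminus\psi^{-1}(0))$;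 $(i_4')$ $g$ is decreasing in $A$ and $\alpha'(\lambda)\psi(x)>0$ for all $(\lambda,x)\in A\times(X\setminus\psi^{-1}(0))$. Then $$\Phi(x)=\begin{cases}\alpha\left(g^{-1}\left(-\frac{\varphi(x)}{\psi(x)}\right)\right)\varphi(x)+\beta\left(g^{-1}\left(-\frac{\varphi(x)}{\psi(x)}\right)\right)\psi(x)+\omega(x) & \text{if } x\in X\setminus\psi^{-1}(0),\\ \sup_{\lambda\in I}\left(\alpha(\lambda)\varphi(x)+\omega(x)\right) & \text{if } x\in\psi^{-1}(0),\end{cases}$$ and $$\inf_X\Phi=\sup_{\lambda\in I}\inf_{x\in X}\left(\alpha(\lambda)\varphi(x)+\beta(\lambda)\psi(x)+\omega(x)\right).$$
   Context: A function $\eta:Y\to\mathbb{R}$ on a topological space $Y$ is called inf-connected if, for each $r\in\mathbb{R}$, the set $\eta^{-1}(]-\infty,r[)$ is connected (the empty set is regarded as connected), and inf-compact if, for each $r\in\mathbb{R}$, the set $\eta^{-1}(]-\infty,r])$ is compact. The prefix $\tau_1$- means that the property refers to the topology $\tau_1$. Derivatives at an endpoint of $I$ belonging to $A$ are one-sided. $g^{-1}:g(A)\to A$ is the inverse of the injective function $g:A\to\mathbb{R}$. Infima and suprema are taken in the extended real line. *)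

theory Defs
  imports "HOL-Analysis.Analysis"
begin

definition lower_semicontinuous_map :: "'a topology \<Rightarrow> ('a \<Rightarrow> real) \<Rightarrow> bool"
  where "lower_semicontinuous_map T \<eta> \<longleftrightarrow> (\<forall>r. openin T {x \<in> topspace T. r < \<eta> x})"

definition inf_connected :: "'a topology \<Rightarrow> ('a \<Rightarrow> real) \<Rightarrow> bool"
  where "inf_connected T \<eta> \<longleftrightarrow> (\<forall>r. connectedin T {x \<in> topspace T. \<eta> x < r})"

definition inf_compact :: "'a topology \<Rightarrow> ('a \<Rightarrow> real) \<Rightarrow> bool"
  where "inf_compact T \<eta> \<longleftrightarrow> (\<forall>r. compactin T {x \<in> topspace T. \<eta> x \<le> r})"

end

theory Submission
  imports Defs
begin

text \<open>
  For fixed \<open>x\<close> with \<open>\<psi> x \<noteq> 0\<close> the derivative of \<open>\<lambda>l. f l x\<close> is \<open>\<alpha>' l * \<psi> x * (\<phi> x / \<psi> x + g l)\<close>,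
  which changes sign from \<open>+\<close> to \<open>-\<close> at the zero of the second factor; for \<open>\<psi> x = 0\<close> the function
  is an affine function of the injective \<open>\<alpha>\<close>.  Either way it is quasi-concave, and the minimax
  equality follows by connectedness: if \<open>r\<close> lies strictly between the two sides, each \<open>x\<close> in the
  nonempty sublevel set \<open>{f l < r}\<close> has the interval \<open>{\<mu>. r < f \<mu> x}\<close> wholly to the left or wholly
  to the right of \<open>l\<close>.  Inf-connectedness on a dense set prevents both kinds from occurring at one
  parameter, so \<open>I\<close> splits into two disjoint open sets; compactness makes both nonempty.
\<close>

lemma minimax_interval_quasiconcave:
  fixes X T1 :: "'a topology" and I D :: "real set" and f :: "real \<Rightarrow> 'a \<Rightarrow> real"
  assumes I: "is_interval I"
    and contX: "\<And>l. l \<in> I \<Longrightarrow> continuous_map X euclideanreal (f l)"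
    and contI: "\<And>x. x \<in> topspace X \<Longrightarrow> continuous_on I (\<lambda>l. f l x)"
    and quasiconcave: "\<And>x a l b. x \<in> topspace X \<Longrightarrow> a \<in> I \<Longrightarrow> b \<in> I \<Longrightarrow> a < l \<Longrightarrow> l < b \<Longrightarrow>
      min (f a x) (f b x) \<le> f l x"
    and T1: "topspace T1 = topspace X"
    and lsc: "\<And>l. l \<in> I \<Longrightarrow> lower_semicontinuous_map T1 (f l)"
    and l0: "l0 \<in> I" "inf_compact T1 (f l0)"
    and D: "D \<subseteq> I" "I \<subseteq> closure D" "\<And>l. l \<in> D \<Longrightarrow> inf_connected X (f l)"
  shows "(INF x\<in>topspace X. SUP l\<in>I. ereal (f l x)) = (SUP l\<in>I. INF x\<in>topspace X. ereal (f l x))"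
proof (rule antisym)
  show "(SUP l\<in>I. INF x\<in>topspace X. ereal (f l x)) \<le> (INF x\<in>topspace X. SUP l\<in>I. ereal (f l x))"
    by (intro SUP_least INF_greatest order_trans[OF INF_lower SUP_upper])
  show "(INF x\<in>topspace X. SUP l\<in>I. ereal (f l x)) \<le> (SUP l\<in>I. INF x\<in>topspace X. ereal (f l x))"
  proof (rule ccontr)
    assume "\<not> ?thesis"
    then obtain r where r1: "(SUP l\<in>I. INF x\<in>topspace X. ereal (f l x)) < ereal r"
      and r2: "ereal r < (INF x\<in>topspace X. SUP l\<in>I. ereal (f l x))"
      using ereal_dense2 by (metis not_le)
    define S where "S l = {x \<in> topspace X. f l x < r}" for l
    have S_ne: "\<exists>x. x \<in> S l" if "l \<in> I" for l
    proof -
      have "(INF x\<in>topspace X. ereal (f l x)) < ereal r"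
        using SUP_upper[OF that] r1 by (rule le_less_trans)
      then show ?thesis
        by (auto simp: S_def INF_less_iff)
    qed
    have above: "\<exists>l\<in>I. r < f l x" if "x \<in> topspace X" for x
    proof -
      have "ereal r < (SUP l\<in>I. ereal (f l x))"
        using r2 INF_lower[OF that] by (rule less_le_trans)
      then show ?thesis
        by (auto simp: less_SUP_iff)
    qed
    \<comment> \<open>Points of the sublevel set sorted by the side of \<open>l\<close> on which a
      value above \<open>r\<close> occurs. Writing them with unions of open superlevel sets makes
      both open at once.\<close>
    define L where "L l = S l \<inter> (\<Union>m\<in>{m\<in>I. m < l}. {x \<in> topspace X. r < f m x})" for l
    define R where "R l = S l \<inter> (\<Union>m\<in>{m\<in>I. l < m}. {x \<in> topspace X. r < f m x})" for l
    have open_above: "openin X {x \<in> topspace X. r < f m x}" if "m \<in> I" for m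
      using openin_continuous_map_preimage[OF contX[OF that], of "{r<..}"] by auto
    have open_below: "openin X (S m)" if "m \<in> I" for m
      using openin_continuous_map_preimage[OF contX[OF that], of "{..<r}"] by (auto simp: S_def)
    have LR_open: "openin X (L l)" "openin X (R l)" if "l \<in> I" for l
      unfolding L_def R_def
      by (intro openin_Int openin_Union open_below that; use open_above in auto)+
    have LR_cover: "S l = L l \<union> R l" if "l \<in> I" for l
    proof -
      have "x \<in> L l \<union> R l" if x: "x \<in> S l" for x
      proof -
        obtain m where "m \<in> I" "r < f m x" using above x by (auto simp: S_def)
        moreover have "m \<noteq> l" using x \<open>r < f m x\<close> by (auto simp: S_def)
        ultimately show ?thesis using x by (auto simp: L_def R_def S_def neq_iff)
      qed
      then show ?thesis by (auto simp: L_def R_def)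
    qed
    \<comment> \<open>A common point would have values above \<open>r\<close> on both sides of
      \<open>l\<close> but a value below \<open>r\<close> at \<open>l\<close>, against
      quasi-concavity.\<close>
    have LR_disjoint: "L l \<inter> R l = {}" for l
    proof -
      have False if x: "x \<in> topspace X" "f l x < r"
        and "a \<in> I" "a < l" "r < f a x" "b \<in> I" "l < b" "r < f b x" for x a b
        using quasiconcave[of x a b l] that by auto
      then show ?thesis unfolding L_def R_def S_def by blast
    qed
    have near: "\<exists>e>0. \<forall>l\<in>I. dist l c < e \<longrightarrow> f l x < r" if "c \<in> I" "x \<in> S c" for c x
    proof -
      have "continuous (at c within I) (\<lambda>l. f l x)"
        using contI[of x] that by (auto simp: S_def continuous_on_eq_continuous_within)
      then have "\<forall>\<^sub>F l in at c within I. f l x < r"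
        using that by (auto simp: S_def continuous_within intro: order_tendstoD)
      \<comment> \<open>The filter \<open>at c within I\<close> says nothing about \<open>c\<close>
        itself; there the bound is \<open>x \<in> S c\<close>.\<close>
      then show ?thesis
        using that by (force simp: eventually_at S_def)
    qed
    \<comment> \<open>The same \<open>x\<close> and the same witness \<open>m\<close> serve all
      nearby parameters: \<open>e\<close> keeps \<open>x\<close> in the sublevel set, and the radius
      \<open>c - m\<close> keeps \<open>m\<close> to the left.\<close>
    have L_near: "\<exists>e>0. \<forall>l\<in>I. dist l c < e \<longrightarrow> L l \<noteq> {}" if c: "c \<in> I" "L c \<noteq> {}" for c
    proof -
      obtain x m where x: "x \<in> S c" "m \<in> I" "m < c" "r < f m x" using c by (auto simp: L_def)
      obtain e where e: "e > 0" "\<forall>l\<in>I. dist l c < e \<longrightarrow> f l x < r"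
        using near[OF c(1) x(1)] by blast
      have "x \<in> L l" if "l \<in> I" "dist l c < min e (c - m)" for l
        using that x e by (auto simp: L_def S_def dist_real_def)
      then show ?thesis
        using e x by (intro exI[of _ "min e (c - m)"]) auto
    qed
    have R_near: "\<exists>e>0. \<forall>l\<in>I. dist l c < e \<longrightarrow> R l \<noteq> {}" if c: "c \<in> I" "R c \<noteq> {}" for c
    proof -
      obtain x m where x: "x \<in> S c" "m \<in> I" "c < m" "r < f m x" using c by (auto simp: R_def)
      obtain e where e: "e > 0" "\<forall>l\<in>I. dist l c < e \<longrightarrow> f l x < r"
        using near[OF c(1) x(1)] by blast
      have "x \<in> R l" if "l \<in> I" "dist l c < min e (m - c)" for l
        using that x e by (auto simp: R_def S_def dist_real_def)
      then show ?thesis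
        using e x by (intro exI[of _ "min e (m - c)"]) auto
    qed
    have D_one: "L l = {} \<or> R l = {}" if "l \<in> D" for l
    proof -
      have l: "l \<in> I" using that D by auto
      have "connectedin X (S l)" using D(3)[OF that] by (auto simp: inf_connected_def S_def)
      then show ?thesis
        using LR_open[OF l] LR_cover[OF l] LR_disjoint[of l] unfolding connectedin by blast
    qed
    \<comment> \<open>Nonemptiness of both sets at \<open>c\<close> would persist on a neighbourhood
      of \<open>c\<close> in \<open>I\<close>, which by density contains a point of
      \<open>D\<close>.\<close>
    have one: "L c = {} \<or> R c = {}" if c: "c \<in> I" for c
    proof (rule ccontr)
      assume "\<not> ?thesis"
      then obtain d e where d: "d > 0" "\<forall>l\<in>I. dist l c < d \<longrightarrow> L l \<noteq> {}"
        and e: "e > 0" "\<forall>l\<in>I. dist l c < e \<longrightarrow> R l \<noteq> {}"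
        using L_near[OF c] R_near[OF c] by blast
      obtain l where "l \<in> D" "dist l c < min d e"
        using c D(2) d(1) e(1) by (meson closure_approachable min_less_iff_conj subsetD)
      then show False
        using d(2) e(2) D(1) D_one[of l] by (meson min_less_iff_conj subsetD)
    qed
    have openL: "openin (top_of_set I) {c\<in>I. L c \<noteq> {}}"
      using L_near unfolding openin_euclidean_subtopology_iff by auto
    have openR: "openin (top_of_set I) {c\<in>I. R c \<noteq> {}}"
      using R_near unfolding openin_euclidean_subtopology_iff by auto
    have cover: "{c\<in>I. L c \<noteq> {}} \<union> {c\<in>I. R c \<noteq> {}} = I"
      using S_ne LR_cover by blast
    have disjoint: "{c\<in>I. L c \<noteq> {}} \<inter> {c\<in>I. R c \<noteq> {}} = {}"
      using one by auto
    \<comment> \<open>The topology \<open>T1\<close> enters only here. The superlevel sets cover the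
      compact set where \<open>f l0\<close> is at most \<open>r\<close>, so finitely many suffice
      there; at all other points \<open>l0\<close> itself is a witness, hence its insertion into
      \<open>F\<close>.\<close>
    obtain F where F: "finite F" "F \<subseteq> I" "l0 \<in> F" "\<And>x. x \<in> topspace X \<Longrightarrow> \<exists>m\<in>F. r < f m x"
    proof -
      let ?U = "\<lambda>m. {x \<in> topspace T1. r < f m x}"
      have cpt: "compactin T1 {x \<in> topspace T1. f l0 x \<le> r}"
        using l0 by (auto simp: inf_compact_def)
      have "openin T1 V" if "V \<in> ?U ` I" for V
        using lsc that by (auto simp: lower_semicontinuous_map_def)
      moreover have "{x \<in> topspace T1. f l0 x \<le> r} \<subseteq> \<Union> (?U ` I)"
        using above T1 by auto
      ultimately obtain \<F> where "finite \<F>" "\<F> \<subseteq> ?U ` I" "{x \<in> topspace T1. f l0 x \<le> r} \<subseteq> \<Union>\<F>"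
        using compactinD[OF cpt, of "?U ` I"] by blast
      then obtain F where F: "finite F" "F \<subseteq> I" "{x \<in> topspace T1. f l0 x \<le> r} \<subseteq> \<Union> (?U ` F)"
        using finite_subset_image[of \<F> ?U I] by blast
      have "\<exists>m\<in>insert l0 F. r < f m x" if "x \<in> topspace X" for x
        using F(3) that T1 by (cases "f l0 x \<le> r") auto
      then show ?thesis
        using that[of "insert l0 F"] F l0 by auto
    qed
    have "Min F \<in> I" "Max F \<in> I"
      using F Min_in[of F] Max_in[of F] by blast+
    \<comment> \<open>A point of \<open>S (Min F)\<close> has a witness in \<open>F\<close> other
      than \<open>Min F\<close>, so the witness lies to the right. The argument for
      \<open>Max F\<close> is symmetric.\<close>
    have "R (Min F) \<noteq> {}"
    proof -
      obtain x where x: "x \<in> S (Min F)" using S_ne[OF \<open>Min F \<in> I\<close>] by blast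
      then obtain m where m: "m \<in> F" "r < f m x" using F(4) by (auto simp: S_def)
      then have "Min F \<le> m" "Min F \<noteq> m" using x F(1) by (auto simp: S_def)
      then show ?thesis using x m F(2) by (force simp: R_def S_def)
    qed
    moreover have "L (Max F) \<noteq> {}"
    proof -
      obtain x where x: "x \<in> S (Max F)" using S_ne[OF \<open>Max F \<in> I\<close>] by blast
      then obtain m where m: "m \<in> F" "r < f m x" using F(4) by (auto simp: S_def)
      then have "m \<le> Max F" "Max F \<noteq> m" using x F(1) by (auto simp: S_def)
      then show ?thesis using x m F(2) by (force simp: L_def S_def)
    qed
    \<comment> \<open>The two classes of parameters are open in \<open>I\<close>, disjoint, cover
      \<open>I\<close>, and contain \<open>Max F\<close> and \<open>Min F\<close> respectively,
      contradicting connectedness of the interval.\<close>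
    ultimately show False
      using I openL openR cover disjoint \<open>Min F \<in> I\<close> \<open>Max F \<in> I\<close>
      unfolding is_interval_connected_1 connected_openin_eq
      by (metis (mono_tags, lifting) empty_iff mem_Collect_eq)
  qed
qed

text \<open>A continuous injection on an interval is strictly monotone, so its value at
  \<open>l\<close> lies between those at \<open>a\<close> and \<open>b\<close>; scaling by a
  constant of either sign preserves betweenness. This serves the points with
  \<open>\<psi> x = 0\<close>.\<close>

lemma quasiconcave_if_inj:
  fixes h :: "real \<Rightarrow> real"
  assumes "is_interval I" "continuous_on I h" "inj_on h I" "a \<in> I" "b \<in> I" "a < l" "l < b"
  shows "min (c * h a) (c * h b) \<le> c * h l"
proof -
  have "{a..b} \<subseteq> I"
    using mem_is_interval_1_I[OF assms(1,4,5)] by auto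
  then have "(h a < h l \<and> h l < h b) \<or> (h b < h l \<and> h l < h a)"
    using continuous_inj_imp_mono[of a l b h] assms(6,7)
      continuous_on_subset[OF assms(2)] inj_on_subset[OF assms(3)] by blast
  then show ?thesis
    by (cases "c \<ge> 0") (auto simp: min_le_iff_disj mult_left_mono mult_left_mono_neg)
qed

text \<open>Rolle's theorem: equal values at two points would force a zero of the derivative
  strictly between them. Derivatives are asked for only in the interior, as endpoints of
  \<open>I\<close> may lie outside \<open>A\<close>.\<close>

lemma inj_on_interval_if_deriv_nonzero:
  fixes h h' :: "real \<Rightarrow> real"
  assumes I: "is_interval I" and cont: "continuous_on I h"
    and deriv: "\<And>l. l \<in> interior I \<Longrightarrow> (h has_real_derivative h' l) (at l)"
    and nz: "\<And>l. l \<in> interior I \<Longrightarrow> h' l \<noteq> 0"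
  shows "inj_on h I"
proof (rule linorder_inj_onI)
  fix a b assume ab: "a < b" "a \<in> I" "b \<in> I"
  then have sub: "{a..b} \<subseteq> I" using mem_is_interval_1_I[OF I ab(2,3)] by auto
  have int: "{a<..<b} \<subseteq> interior I"
    using sub by (intro interior_maximal) auto
  show "h a \<noteq> h b"
  proof
    assume "h a = h b"
    moreover have "h differentiable (at z)" if "a < z" "z < b" for z
    proof -
      have "z \<in> interior I" using int that by auto
      then show ?thesis using deriv real_differentiable_def by blast
    qed
    ultimately obtain z where z: "a < z" "z < b" "(h has_real_derivative 0) (at z)"
      using Rolle[OF ab(1) _ continuous_on_subset[OF cont sub]] by blast
    then have "z \<in> interior I"
      using int by auto
    then show False
      using DERIV_unique[OF deriv z(3)] nz by blast
  qed
qed auto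

text \<open>The mean value theorem on each side of \<open>m\<close>, with continuity carrying
  monotonicity up to endpoints. The two halves give both that \<open>m\<close> is a maximizer and
  that \<open>h\<close> is quasi-concave.\<close>

lemma unimodal_if_deriv_sign_change:
  fixes h h' :: "real \<Rightarrow> real"
  assumes I: "is_interval I" and cont: "continuous_on I h"
    and deriv: "\<And>l. l \<in> interior I \<Longrightarrow> (h has_real_derivative h' l) (at l)"
    and m: "m \<in> I"
    and left: "\<And>l. l \<in> interior I \<Longrightarrow> l < m \<Longrightarrow> h' l \<ge> 0"
    and right: "\<And>l. l \<in> interior I \<Longrightarrow> m < l \<Longrightarrow> h' l \<le> 0"
  shows "\<And>a b. a \<in> I \<Longrightarrow> a \<le> b \<Longrightarrow> b \<le> m \<Longrightarrow> h a \<le> h b"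
    and "\<And>a b. b \<in> I \<Longrightarrow> a \<le> b \<Longrightarrow> m \<le> a \<Longrightarrow> h b \<le> h a"
proof -
  have sub: "{a..b} \<subseteq> I" if "a \<in> I" "b \<in> I" for a b
    using mem_is_interval_1_I[OF I that] by auto
  have int: "{a<..<b} \<subseteq> interior I" if "a \<in> I" "b \<in> I" for a b
    using sub[OF that] by (intro interior_maximal) auto
  show "h a \<le> h b" if "a \<in> I" "a \<le> b" "b \<le> m" for a b
  proof (rule DERIV_nonneg_imp_increasing_open[OF \<open>a \<le> b\<close>])
    have b: "b \<in> I" using mem_is_interval_1_I[OF I that(1) m] that by auto
    show "continuous_on {a..b} h" using continuous_on_subset[OF cont sub[OF that(1) b]] .
    fix x assume x: "a < x" "x < b"
    then have "x \<in> interior I" using int[OF that(1) b] by auto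
    then show "\<exists>y. DERIV h x :> y \<and> 0 \<le> y"
      using deriv[of x] left[of x] x \<open>b \<le> m\<close> by (intro exI[of _ "h' x"]) simp
  qed
  show "h b \<le> h a" if "b \<in> I" "a \<le> b" "m \<le> a" for a b
  proof (rule DERIV_nonpos_imp_decreasing_open[OF \<open>a \<le> b\<close>])
    have a: "a \<in> I" using mem_is_interval_1_I[OF I m that(1)] that by auto
    show "continuous_on {a..b} h" using continuous_on_subset[OF cont sub[OF a that(1)]] .
    fix x assume x: "a < x" "x < b"
    then have "x \<in> interior I" using int[OF a that(1)] by auto
    then show "\<exists>y. DERIV h x :> y \<and> y \<le> 0"
      using deriv[of x] right[of x] x \<open>m \<le> a\<close> by (intro exI[of _ "h' x"]) simp
  qed
qed

theorem theorem1p2: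
  fixes X :: "'a topology"
    and I A :: "real set"
    and \<phi> \<psi> \<omega> :: "'a \<Rightarrow> real"
    and \<alpha> \<beta> \<alpha>' \<beta>' :: "real \<Rightarrow> real"
    and f :: "real \<Rightarrow> 'a \<Rightarrow> real"
    and g :: "real \<Rightarrow> real"
    and \<Phi> :: "'a \<Rightarrow> ereal"
  defines "f \<equiv> \<lambda>l x. \<alpha> l * \<phi> x + \<beta> l * \<psi> x + \<omega> x"
    and "g \<equiv> \<lambda>l. \<beta>' l / \<alpha>' l"
    and "\<Phi> \<equiv> \<lambda>x. SUP l\<in>I. ereal (f l x)"
  assumes I: "is_interval I"
    and cont_X: "continuous_map X euclideanreal \<phi>" "continuous_map X euclideanreal \<psi>"
      "continuous_map X euclideanreal \<omega>"
    and cont_I: "continuous_on I \<alpha>" "continuous_on I \<beta>"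
    and i0: "\<exists>T1. topspace T1 = topspace X \<and>
      (\<forall>l\<in>I. lower_semicontinuous_map T1 (f l)) \<and> (\<exists>l0\<in>I. inf_compact T1 (f l0))"
    and i1: "\<exists>D. D \<subseteq> I \<and> I \<subseteq> closure D \<and> (\<forall>l\<in>D. inf_connected X (f l))"
    and A: "interior I \<subseteq> A" "A \<subseteq> I"
    and deriv_\<alpha>: "\<And>l. l \<in> A \<Longrightarrow> (\<alpha> has_real_derivative \<alpha>' l) (at l within I)"
    and deriv_\<beta>: "\<And>l. l \<in> A \<Longrightarrow> (\<beta> has_real_derivative \<beta>' l) (at l within I)"
    and \<alpha>'_nz: "\<And>l. l \<in> A \<Longrightarrow> \<alpha>' l \<noteq> 0"
    and g_mono: "strict_mono_on A g \<or> strict_antimono_on A g"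
    and g_range: "\<And>x. x \<in> topspace X \<Longrightarrow> \<psi> x \<noteq> 0 \<Longrightarrow> - (\<phi> x / \<psi> x) \<in> g ` A"
    and i34: "(mono_on A g \<and> (\<forall>l\<in>A. \<forall>x\<in>topspace X. \<psi> x \<noteq> 0 \<longrightarrow> \<alpha>' l * \<psi> x < 0)) \<or>
      (antimono_on A g \<and> (\<forall>l\<in>A. \<forall>x\<in>topspace X. \<psi> x \<noteq> 0 \<longrightarrow> \<alpha>' l * \<psi> x > 0))"
  shows "(\<forall>x\<in>topspace X. \<Phi> x =
      (if \<psi> x \<noteq> 0
       then let l = the_inv_into A g (- (\<phi> x / \<psi> x))
            in ereal (\<alpha> l * \<phi> x + \<beta> l * \<psi> x + \<omega> x)
       else (SUP l\<in>I. ereal (\<alpha> l * \<phi> x + \<omega> x)))) \<and>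
    (INF x\<in>topspace X. \<Phi> x) = (SUP l\<in>I. INF x\<in>topspace X. ereal (f l x))"
proof -
  have deriv_int: "(\<alpha> has_real_derivative \<alpha>' l) (at l)" "(\<beta> has_real_derivative \<beta>' l) (at l)"
    if "l \<in> interior I" for l
    using deriv_\<alpha>[OF subsetD[OF A(1) that]] deriv_\<beta>[OF subsetD[OF A(1) that]]
    unfolding at_within_interior[OF that] .
  have inj_g: "inj_on g A"
    using g_mono
  proof
    assume anti: "strict_antimono_on A g"
    show ?thesis
    proof (rule linorder_inj_onI)
      fix a b assume "a < b" "a \<in> A" "b \<in> A"
      then show "g a \<noteq> g b"
        using monotone_onD[OF anti, of a b] by simp
    qed auto
  qed (rule strict_mono_on_imp_inj_on)
  have contf: "continuous_on I (\<lambda>l. f l x)" for x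
    unfolding f_def by (intro continuous_intros cont_I)
  \<comment> \<open>The critical parameter: \<open>g (p x) = - (\<phi> x / \<psi> x)\<close> says
    exactly that \<open>f' l x\<close>, defined below, vanishes at \<open>l = p x\<close>.\<close>
  define p where "p x = the_inv_into A g (- (\<phi> x / \<psi> x))" for x
  have p: "p x \<in> A" "g (p x) = - (\<phi> x / \<psi> x)" if "x \<in> topspace X" "\<psi> x \<noteq> 0" for x
    unfolding p_def using the_inv_into_into[OF inj_g g_range[OF that] order_refl]
      f_the_inv_into_f[OF inj_g g_range[OF that]] by simp_all
  define f' where "f' l x = \<alpha>' l * \<phi> x + \<beta>' l * \<psi> x" for l x
  have derivf: "((\<lambda>l. f l x) has_real_derivative f' l x) (at l)" if "l \<in> interior I" for l x
    unfolding f_def f'_def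
    using DERIV_add[OF DERIV_add[OF DERIV_cmult_right[OF deriv_int(1)[OF that]]
          DERIV_cmult_right[OF deriv_int(2)[OF that]]] DERIV_const]
    by simp
  \<comment> \<open>With \<open>- (\<phi> x / \<psi> x)\<close> replaced by \<open>g (p x)\<close>,
    the sign of the last factor can be read off from the monotonicity of \<open>g\<close>.\<close>
  have f'_eq: "f' l x = \<alpha>' l * \<psi> x * (g l - g (p x))"
    if "l \<in> A" "x \<in> topspace X" "\<psi> x \<noteq> 0" for l x
    unfolding p(2)[OF that(2,3)]
    using \<alpha>'_nz[OF that(1)] that(3) by (simp add: f'_def g_def field_simps)
  \<comment> \<open>Passing from one alternative of \<open>i34\<close> to the other flips the signs
    of both factors, so the product changes sign in the same direction.\<close>
  have sign: "(l < p x \<longrightarrow> 0 \<le> f' l x) \<and> (p x < l \<longrightarrow> f' l x \<le> 0)"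
    if "l \<in> interior I" "x \<in> topspace X" "\<psi> x \<noteq> 0" for l x
  proof -
    have l: "l \<in> A" using that(1) A(1) by blast
    note pA = p(1)[OF that(2,3)]
    show ?thesis
      using i34
    proof (elim disjE conjE)
      assume g: "mono_on A g" and "\<forall>l\<in>A. \<forall>x\<in>topspace X. \<psi> x \<noteq> 0 \<longrightarrow> \<alpha>' l * \<psi> x < 0"
      then have "\<alpha>' l * \<psi> x < 0" using l that by blast
      then show ?thesis
        unfolding f'_eq[OF l that(2,3)]
        using monotone_onD[OF g l pA] monotone_onD[OF g pA l]
          mult_nonpos_nonpos[of "\<alpha>' l * \<psi> x" "g l - g (p x)"]
          mult_nonpos_nonneg[of "\<alpha>' l * \<psi> x" "g l - g (p x)"] by simp
    next
      assume g: "antimono_on A g" and "\<forall>l\<in>A. \<forall>x\<in>topspace X. \<psi> x \<noteq> 0 \<longrightarrow> \<alpha>' l * \<psi> x > 0"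
      then have "\<alpha>' l * \<psi> x > 0" using l that by blast
      then show ?thesis
        unfolding f'_eq[OF l that(2,3)]
        using monotone_onD[OF g l pA] monotone_onD[OF g pA l]
          mult_nonneg_nonneg[of "\<alpha>' l * \<psi> x" "g l - g (p x)"]
          mult_nonneg_nonpos[of "\<alpha>' l * \<psi> x" "g l - g (p x)"] by simp
    qed
  qed
  have unimodal: "a \<in> I \<Longrightarrow> a \<le> b \<Longrightarrow> b \<le> p x \<Longrightarrow> f a x \<le> f b x"
      "b \<in> I \<Longrightarrow> a \<le> b \<Longrightarrow> p x \<le> a \<Longrightarrow> f b x \<le> f a x"
    if x: "x \<in> topspace X" "\<psi> x \<noteq> 0" for x a b
  proof -
    have "p x \<in> I" using p(1)[OF x] A by auto
    note * = unimodal_if_deriv_sign_change[OF I contf derivf this, of x]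
    show "a \<in> I \<Longrightarrow> a \<le> b \<Longrightarrow> b \<le> p x \<Longrightarrow> f a x \<le> f b x"
      by (rule *(1); (assumption | use sign[OF _ x] in blast))
    show "b \<in> I \<Longrightarrow> a \<le> b \<Longrightarrow> p x \<le> a \<Longrightarrow> f b x \<le> f a x"
      by (rule *(2); (assumption | use sign[OF _ x] in blast))
  qed
  have "\<Phi> x = ereal (f (p x) x)" if x: "x \<in> topspace X" "\<psi> x \<noteq> 0" for x
    unfolding \<Phi>_def
  proof (rule antisym)
    show "(SUP l\<in>I. ereal (f l x)) \<le> ereal (f (p x) x)"
    proof (rule SUP_least)
      fix l assume "l \<in> I"
      then show "ereal (f l x) \<le> ereal (f (p x) x)"
        using unimodal(1)[OF x, of l "p x"] unimodal(2)[OF x, of l "p x"]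
        by (cases "l \<le> p x") simp_all
    qed
    show "ereal (f (p x) x) \<le> (SUP l\<in>I. ereal (f l x))"
      using p(1)[OF x] A by (intro SUP_upper) auto
  qed
  moreover have "\<Phi> x = (SUP l\<in>I. ereal (\<alpha> l * \<phi> x + \<omega> x))" if "\<psi> x = 0" for x
    using that by (simp add: \<Phi>_def f_def)
  moreover have "(INF x\<in>topspace X. \<Phi> x) = (SUP l\<in>I. INF x\<in>topspace X. ereal (f l x))"
  proof -
    \<comment> \<open>Where \<open>\<psi> x = 0\<close> there is no critical parameter;
      \<open>f l x\<close> reduces to \<open>\<alpha> l * \<phi> x + \<omega> x\<close>, and
      injectivity of \<open>\<alpha>\<close> takes over.\<close>
    have inj_\<alpha>: "inj_on \<alpha> I"
      using inj_on_interval_if_deriv_nonzero[OF I cont_I(1) deriv_int(1)] \<alpha>'_nz A(1) by blast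
    have quasiconcave: "min (f a x) (f b x) \<le> f l x"
      if "x \<in> topspace X" "a \<in> I" "b \<in> I" "a < l" "l < b" for x a l b
    proof (cases "\<psi> x = 0")
      case True
      then show ?thesis
        using quasiconcave_if_inj[OF I cont_I(1) inj_\<alpha> that(2-), of "\<phi> x"]
        by (simp add: True f_def mult.commute min_le_iff_disj)
    next
      case False
      then show ?thesis
        \<comment> \<open>If \<open>l\<close> is at most \<open>p x\<close>, its value dominates
          that at \<open>a\<close>; otherwise it dominates that at \<open>b\<close>.\<close>
        using unimodal(1)[OF that(1) False, of a l] unimodal(2)[OF that(1) False, of b l] that(2-)
        by (cases "l \<le> p x") (simp_all add: min_le_iff_disj)
    qed
    obtain T1 l0 where T1: "topspace T1 = topspace X" "\<And>l. l \<in> I \<Longrightarrow> lower_semicontinuous_map T1 (f l)"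
      and l0: "l0 \<in> I" "inf_compact T1 (f l0)"
      using i0 by blast
    obtain D where D: "D \<subseteq> I" "I \<subseteq> closure D" "\<And>l. l \<in> D \<Longrightarrow> inf_connected X (f l)"
      using i1 by blast
    have "continuous_map X euclideanreal (f l)" for l
      unfolding f_def by (intro continuous_intros cont_X)
    then show ?thesis
      unfolding \<Phi>_def
      using minimax_interval_quasiconcave[OF I _ contf quasiconcave T1 l0 D] by blast
  qed
  ultimately show ?thesis
    by (auto simp: p_def f_def Let_def)
qed

end
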